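(* Let $N \ge 1$, let $\mathcal{A}$ be a finite set, and let $\mathbf{X} = (X_1,\dots,X_N)$ be the coordinate sequence on $\mathcal{A}^N$ under the probability measure $\mathbb{P}$ induced by a family of transition kernels $\{p_i\}_{i=1}^N$. Let $H$ be the causal interdependence matrix of $\{p_i\}_{i=1}^N$ and let $\Gamma = (I-H)^{-1}$. Let $f:\mathcal{A}^N \to \mathbb{R}$ and $\mathbf{c} = (c_1,\dots,c_N)^\top \in \mathbb{R}^N$ be such that $|f(x)-f(y)| \le \sum_{j=1}^N c_j \mathbf{1}_{\{x_j \ne y_j\}}$ for all $x,y \in \mathcal{A}^N$. Then for every $t > 0$, $$\mathbb{P}\bigl(|f(\mathbf{X}) - \mathbb{E}[f(\mathbf{X})]| \ge t\bigr) \le 2\exp\left(-\frac{2t^2}{\|\Gamma \mathbf{c}\|_2^2}\right),$$ where $\|\Gamma\mathbf{c}\|_2^2 = \sum_{k=1}^N (\Gamma\mathbf{c})_k^2$.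
   Context: Setting. $\mathcal{A}$ is an arbitrary finite set and $\mathcal{A}^N$ carries the discrete $\sigma$-algebra. For each $i \in \{1,\dots,N\}$ and each history $x_{1:i-1} = (x_1,\dots,x_{i-1}) \in \mathcal{A}^{i-1}$, $p_i(\cdot \mid x_{1:i-1})$ is a probability measure on $\mathcal{A}$ (kernels are specified for all histories, including those of probability zero; for $i=1$ the history is empty). The measure $\mathbb{P}$ on $\mathcal{A}^N$ is defined by $\mathbb{P}(X_{1:N}=x_{1:N}) = \prod_{i=1}^N p_i(x_i \mid x_{1:i-1})$, where $X_i(x)=x_i$ are the coordinate projections; $\mathbb{E}$ is expectation under $\mathbb{P}$. Total variation distance on $\mathcal{A}$: $d_{\mathrm{TV}}(\mu,\nu) = \frac12 \sum_{a\in\mathcal{A}} |\mu(a)-\nu(a)|$. Causal interdependence matrix $H\in\mathbb{R}^{N\times N}$: $H_{i,j}=0$ for $i \ge j$, and for $1\le i<j\le N$, $$H_{i,j} = \max_{\mathbf{z}\in\mathcal{A}^{i-1},\ x,x'\in\mathcal{A},\ \mathbf{w}\in\mathcal{A}^{j-i-1}} d_{\mathrm{TV}}\bigl(p_j(\cdot\mid \mathbf{z},x,\mathbf{w}),\, p_j(\cdot\mid\mathbf{z},x',\mathbf{w})\bigr).$$ Since $H$ is strictly upper triangular, $I-H$ is invertible; the causal resolvent matrix is $\Gamma = (I-H)^{-1} = \sum_{r=0}^{N-1} H^r$. Convention: if the denominator in the exponent is $0$ (which happens only if $\mathbf{c}=0$), the right-hand side is read as $0$. *)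

theory Defs
  imports
    "HOL-Probability.Probability_Mass_Function"
    "Jordan_Normal_Form.Gauss_Jordan_Elimination"
    "Jordan_Normal_Form.Determinant"
begin

no_notation Finite_Cartesian_Product.vec_nth (infixl "$" 90)
hide_type (open) Finite_Cartesian_Product.vec

text \<open>
  Indices run over \<open>{..<N}\<close> rather than \<open>{1..N}\<close>, as in the matrix library. A point of
  \<open>\<A>\<^sup>n\<close> is a list of length \<open>n\<close> over the finite type \<open>'a\<close>. The kernel \<open>p i h\<close> is the
  conditional law of coordinate \<open>i\<close> given the history \<open>h\<close>; it is only used when \<open>h\<close>
  has length \<open>i\<close>.
\<close>

definition words :: "nat \<Rightarrow> 'a list set" where
  "words n = {xs. length xs = n}"

definition path_measure :: "nat \<Rightarrow> (nat \<Rightarrow> 'a::finite list \<Rightarrow> 'a pmf) \<Rightarrow> 'a list measure" where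
  "path_measure N p =
     point_measure (words N) (\<lambda>x. ennreal (\<Prod>i<N. pmf (p i (take i x)) (x ! i)))"

definition tv_dist :: "'a::finite pmf \<Rightarrow> 'a pmf \<Rightarrow> real" where
  "tv_dist \<mu> \<nu> = (1 / 2) * (\<Sum>a\<in>UNIV. \<bar>pmf \<mu> a - pmf \<nu> a\<bar>)"

definition interdependence_mat :: "nat \<Rightarrow> (nat \<Rightarrow> 'a::finite list \<Rightarrow> 'a pmf) \<Rightarrow> real mat" where
  "interdependence_mat N p = Matrix.mat N N (\<lambda>(i, j).
     if i < j
     then Max {tv_dist (p j (z @ [x] @ w)) (p j (z @ [x'] @ w)) | z x x' w.
                 z \<in> words i \<and> w \<in> words (j - i - 1)}
     else 0)"

definition resolvent_mat :: "nat \<Rightarrow> (nat \<Rightarrow> 'a::finite list \<Rightarrow> 'a pmf) \<Rightarrow> real mat" where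
  "resolvent_mat N p = the (mat_inverse (1\<^sub>m N - interdependence_mat N p))"

lemma finite_words: "finite (words n :: 'a::finite list set)"
  using finite_lists_length_eq[of "UNIV :: 'a set" n] by (simp add: words_def)

lemma words_Suc: "words (Suc n) = (\<lambda>(x, a). x @ [a]) ` (words n \<times> UNIV)"
proof (intro Set.set_eqI iffI)
  fix y :: "'a list" assume "y \<in> words (Suc n)"
  then have "y = butlast y @ [last y]" "butlast y \<in> words n"
    by (auto simp: words_def intro: append_butlast_last_id[symmetric])
  then show "y \<in> (\<lambda>(x, a). x @ [a]) ` (words n \<times> UNIV)"
    by (intro image_eqI[of _ _ "(butlast y, last y)"]) auto
qed (auto simp: words_def)

lemma sum_path_weights:
  "(\<Sum>x\<in>words N. \<Prod>i<N. pmf (p i (take i x)) (x ! i)) = (1::real)"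
  for p :: "nat \<Rightarrow> 'a::finite list \<Rightarrow> 'a pmf"
proof (induction N)
  case 0
  then show ?case by (simp add: words_def)
next
  case (Suc N)
  have inj: "inj_on (\<lambda>(x, a). x @ [a]) (words N \<times> (UNIV :: 'a set))"
    by (auto simp: inj_on_def)
  have "(\<Sum>x\<in>words (Suc N). \<Prod>i<Suc N. pmf (p i (take i x)) (x ! i)) =
      (\<Sum>(x, a)\<in>words N \<times> UNIV. \<Prod>i<Suc N. pmf (p i (take i (x @ [a]))) ((x @ [a]) ! i))"
    unfolding words_Suc by (subst sum.reindex[OF inj]) (simp add: case_prod_unfold)
  also have "\<dots> = (\<Sum>(x, a)\<in>words N \<times> UNIV.
      (\<Prod>i<N. pmf (p i (take i x)) (x ! i)) * pmf (p N x) a)"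
    by (intro sum.cong refl) (auto simp: words_def nth_append intro!: prod.cong)
  also have "\<dots> = (\<Sum>x\<in>words N. (\<Prod>i<N. pmf (p i (take i x)) (x ! i)) * (\<Sum>a\<in>UNIV. pmf (p N x) a))"
    by (simp add: sum.cartesian_product[symmetric] sum_distrib_left)
  also have "\<dots> = 1"
    by (simp add: sum_pmf_eq_1 Suc)
  finally show ?case .
qed

lemma prob_space_path_measure: "prob_space (path_measure N p)"
proof
  have "emeasure (path_measure N p) (space (path_measure N p)) =
      (\<Sum>x\<in>words N. ennreal (\<Prod>i<N. pmf (p i (take i x)) (x ! i)))"
    by (simp add: path_measure_def space_point_measure emeasure_point_measure_finite finite_words)
  also have "\<dots> = 1"
    by (subst sum_ennreal) (auto simp: sum_path_weights intro!: prod_nonneg)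
  finally show "emeasure (path_measure N p) (space (path_measure N p)) = 1" .
qed

lemma resolvent_mat_inverse:
  defines "A N p \<equiv> 1\<^sub>m N - interdependence_mat N p"
  shows "resolvent_mat N p \<in> carrier_mat N N"
    and "A N p * resolvent_mat N p = 1\<^sub>m N"
    and "resolvent_mat N p * A N p = 1\<^sub>m N"
proof -
  have car: "A N p \<in> carrier_mat N N"
    unfolding A_def interdependence_mat_def by auto
  have "det (A N p) = prod_list (diag_mat (A N p))"
    by (rule det_upper_triangular[OF _ car]) (auto simp: A_def interdependence_mat_def)
  also have "diag_mat (A N p) = replicate N 1"
    by (rule nth_equalityI) (auto simp: diag_mat_def A_def interdependence_mat_def)
  finally have "det (A N p) \<noteq> 0" by simp
  then have "A N p \<in> Units (ring_mat TYPE(real) N ())"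
    by (rule det_non_zero_imp_unit[OF car])
  then obtain B where B: "mat_inverse (A N p) = Some B"
    using mat_inverse(1)[OF car, where b = "()"] by (cases "mat_inverse (A N p)") auto
  show "resolvent_mat N p \<in> carrier_mat N N"
    "A N p * resolvent_mat N p = 1\<^sub>m N" "resolvent_mat N p * A N p = 1\<^sub>m N"
    using mat_inverse(2)[OF car B] B by (auto simp: resolvent_mat_def A_def)
qed

end

theory Submission
  imports Defs "HOL-Probability.Hoeffding"
begin

text \<open>
  The proof runs the Azuma--Hoeffding argument along the Doob martingale
  \<open>G k h = E[f | X\<^sub>1 \<dots> X\<^sub>k = h]\<close>. Changing coordinate \<open>i\<close> of \<open>h\<close> changes \<open>G k h\<close> by at most
  \<open>D k i = c i + (\<Sum>k\<le>j<N. H i j * v j)\<close>, where \<open>v = \<Gamma> c\<close>: this holds for \<open>k = N\<close> by the assumption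
  on \<open>f\<close>, and in the step from \<open>k + 1\<close> to \<open>k\<close> the law of coordinate \<open>k\<close> changes by at most
  \<open>H i k\<close> in total variation while \<open>G (k + 1)\<close> oscillates by at most \<open>D (k + 1) k\<close> in
  coordinate \<open>k\<close>. The equation \<open>v = c + H v\<close> says \<open>D (k + 1) k = v k\<close>, so the \<open>k\<close>-th martingale
  difference ranges over an interval of length \<open>v k\<close>, and Hoeffding's lemma applies.
\<close>

section \<open>Finite sums against the path measure\<close>

abbreviation path_weight :: "nat \<Rightarrow> (nat \<Rightarrow> 'a::finite list \<Rightarrow> 'a pmf) \<Rightarrow> 'a list \<Rightarrow> real" where
  "path_weight N p x \<equiv> (\<Prod>i<N. pmf (p i (take i x)) (x ! i))"

lemma path_weight_nonneg: "path_weight N p x \<ge> 0"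
  by (intro prod_nonneg) auto

text \<open>The tower property for the last coordinate: every nonempty word splits uniquely as
  \<open>h @ [a]\<close>, and its weight factors accordingly. Both inductions along the martingale
  rest on it.\<close>

lemma sum_path_weight_Suc:
  fixes F :: "'a::finite list \<Rightarrow> real"
  shows "(\<Sum>x\<in>words (Suc n). path_weight (Suc n) p x * F x) =
    (\<Sum>h\<in>words n. path_weight n p h * (\<Sum>a\<in>UNIV. pmf (p n h) a * F (h @ [a])))"
proof -
  have inj: "inj_on (\<lambda>(x, a). x @ [a]) (words n \<times> (UNIV :: 'a set))"
    by (auto simp: inj_on_def)
  have "(\<Sum>x\<in>words (Suc n). path_weight (Suc n) p x * F x) =
      (\<Sum>(x, a)\<in>words n \<times> UNIV. path_weight (Suc n) p (x @ [a]) * F (x @ [a]))"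
    unfolding words_Suc by (subst sum.reindex[OF inj]) (simp add: case_prod_unfold)
  also have "\<dots> = (\<Sum>(x, a)\<in>words n \<times> UNIV. path_weight n p x * (pmf (p n x) a * F (x @ [a])))"
    by (intro sum.cong refl) (auto simp: words_def nth_append mult.assoc intro!: prod.cong)
  finally show ?thesis
    by (simp add: sum.cartesian_product[symmetric] sum_distrib_left)
qed

lemma measure_path_measure:
  assumes "A \<subseteq> words N"
  shows "measure (path_measure N p) A = (\<Sum>x\<in>A. path_weight N p x)"
proof -
  have "finite A"
    using assms finite_words by (rule finite_subset)
  then have "emeasure (path_measure N p) A = ennreal (\<Sum>x\<in>A. path_weight N p x)"
    unfolding path_measure_def using assms
    by (simp add: emeasure_point_measure_finite finite_words sum_ennreal path_weight_nonneg)
  then show ?thesis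
    by (simp add: measure_def sum_nonneg path_weight_nonneg)
qed

lemma integral_path_measure:
  fixes f :: "'a::finite list \<Rightarrow> real"
  shows "(\<integral>x. f x \<partial>path_measure N p) = (\<Sum>x\<in>words N. path_weight N p x * f x)"
  unfolding path_measure_def
  by (subst lebesgue_integral_point_measure_finite)
     (auto simp: finite_words path_weight_nonneg)

section \<open>Inequalities for a single law on the alphabet\<close>

lemma sum_pmf_diff_le_tv_dist:
  fixes \<mu> \<nu> :: "'a::finite pmf" and g :: "'a \<Rightarrow> real"
  assumes osc: "\<And>a b. \<bar>g a - g b\<bar> \<le> v"
  shows "\<bar>\<Sum>a\<in>UNIV. (pmf \<mu> a - pmf \<nu> a) * g a\<bar> \<le> tv_dist \<mu> \<nu> * v"
proof -
  \<comment> \<open>Both laws have mass 1, so \<open>g\<close> may be shifted by a constant. The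
    midrange makes the deviation at most \<open>v / 2\<close>, which matches the factor 1/2 in
    \<open>tv_dist\<close>.\<close>
  define m where "m = (Max (range g) + Min (range g)) / 2"
  have mid: "\<bar>g a - m\<bar> \<le> v / 2" for a
  proof -
    have "Max (range g) \<in> range g" by (rule Max_in) auto
    then obtain b where b: "g b = Max (range g)" by (metis imageE)
    have "Min (range g) \<in> range g" by (rule Min_in) auto
    then obtain b' where b': "g b' = Min (range g)" by (metis imageE)
    have "g a \<le> g b" "g b' \<le> g a" using b b' by auto
    then show ?thesis using osc[of b b'] unfolding m_def b[symmetric] b'[symmetric] by argo
  qed
  have "(\<Sum>a\<in>UNIV. (pmf \<mu> a - pmf \<nu> a) * m) = 0"
    by (simp add: sum_distrib_right[symmetric] sum_subtractf sum_pmf_eq_1)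
  then have "(\<Sum>a\<in>UNIV. (pmf \<mu> a - pmf \<nu> a) * g a) = (\<Sum>a\<in>UNIV. (pmf \<mu> a - pmf \<nu> a) * (g a - m))"
    by (simp add: right_diff_distrib sum_subtractf)
  also have "\<bar>\<dots>\<bar> \<le> (\<Sum>a\<in>UNIV. \<bar>(pmf \<mu> a - pmf \<nu> a) * (g a - m)\<bar>)"
    by (rule sum_abs)
  also have "\<dots> \<le> (\<Sum>a\<in>UNIV. \<bar>pmf \<mu> a - pmf \<nu> a\<bar> * (v / 2))"
    unfolding abs_mult by (intro sum_mono mult_left_mono mid) auto
  also have "\<dots> = tv_dist \<mu> \<nu> * v"
    unfolding tv_dist_def sum_distrib_right[symmetric] by simp
  finally show ?thesis .
qed

lemma pmf_Hoeffdings_lemma: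
  fixes \<mu> :: "'a::finite pmf" and g :: "'a \<Rightarrow> real"
  assumes osc: "\<And>a b. \<bar>g a - g b\<bar> \<le> v" and "l > 0"
  shows "(\<Sum>a\<in>UNIV. pmf \<mu> a * exp (l * g a))
    \<le> exp (l * (\<Sum>a\<in>UNIV. pmf \<mu> a * g a) + l\<^sup>2 * v\<^sup>2 / 8)"
proof -
  define m where "m = Min (range g)"
  define E where "E = (\<Sum>a\<in>UNIV. pmf \<mu> a * g a)"
  \<comment> \<open>An interval of length \<open>v\<close>, not \<open>2 * v\<close>, is what yields
    the constant 1/8.\<close>
  have range: "g a \<in> {m..m + v}" for a
  proof -
    have "m \<in> range g" unfolding m_def by (rule Min_in) auto
    then obtain b where b: "g b = m" by (metis imageE)
    have "m \<le> g a" by (auto simp: m_def)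
    then show ?thesis using osc[of a b] b by auto
  qed
  interpret interval_bounded_random_variable "measure_pmf \<mu>" g m "m + v"
    by unfold_locales (use range in auto)
  have integral: "measure_pmf.expectation \<mu> F = (\<Sum>a\<in>UNIV. pmf \<mu> a * F a)" for F :: "'a \<Rightarrow> real"
    by (subst integral_measure_pmf[of UNIV]) auto
  have "ennreal (\<Sum>a\<in>UNIV. pmf \<mu> a * exp (l * (g a - E)))
      = (\<integral>\<^sup>+a. ennreal (exp (l * (g a - E))) \<partial>measure_pmf \<mu>)"
    unfolding integral[symmetric]
    by (rule nn_integral_eq_integral[symmetric]) (auto intro: integrable_measure_pmf_finite)
  also have "\<dots> \<le> ennreal (exp (l\<^sup>2 * v\<^sup>2 / 8))"
    using Hoeffdings_lemma_nn_integral[OF \<open>l > 0\<close>] by (simp add: integral E_def)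
  finally have "(\<Sum>a\<in>UNIV. pmf \<mu> a * exp (l * (g a - E))) \<le> exp (l\<^sup>2 * v\<^sup>2 / 8)"
    by simp
  \<comment> \<open>Multiplying by \<open>exp (l * E)\<close> undoes the centring.\<close>
  then have "exp (l * E) * (\<Sum>a\<in>UNIV. pmf \<mu> a * exp (l * (g a - E)))
      \<le> exp (l * E) * exp (l\<^sup>2 * v\<^sup>2 / 8)"
    by (rule mult_left_mono) simp
  moreover have "exp (l * E) * (\<Sum>a\<in>UNIV. pmf \<mu> a * exp (l * (g a - E)))
      = (\<Sum>a\<in>UNIV. pmf \<mu> a * exp (l * g a))"
    unfolding sum_distrib_left
    by (intro sum.cong refl) (simp add: right_diff_distrib exp_diff)
  ultimately show ?thesis
    by (simp only: E_def exp_add)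
qed

section \<open>The Doob martingale: mean, exponential moments and oscillation\<close>

text \<open>The first argument counts the coordinates that are still to be averaged.\<close>

primrec future_mean ::
    "nat \<Rightarrow> (nat \<Rightarrow> 'a::finite list \<Rightarrow> 'a pmf) \<Rightarrow> ('a list \<Rightarrow> real) \<Rightarrow> 'a list \<Rightarrow> real" where
  "future_mean 0 p f h = f h"
| "future_mean (Suc m) p f h =
     (\<Sum>a\<in>UNIV. pmf (p (length h) h) a * future_mean m p f (h @ [a]))"

lemma future_mean_step:
  assumes "k < N" "h \<in> words k"
  shows "future_mean (N - k) p f h =
    (\<Sum>a\<in>UNIV. pmf (p k h) a * future_mean (N - Suc k) p f (h @ [a]))"
  using assms by (simp add: Suc_diff_Suc[symmetric] words_def)

text \<open>The martingale property: the mean is the same at every level. At \<open>k = N\<close> it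
  identifies \<open>future_mean N p f []\<close> as the expectation of \<open>f\<close>.\<close>

lemma expectation_future_mean:
  "k \<le> N \<Longrightarrow> (\<Sum>x\<in>words k. path_weight k p x * future_mean (N - k) p f x) = future_mean N p f []"
proof (induction k)
  case 0
  then show ?case by (simp add: words_def)
next
  case (Suc k)
  then show ?case
    by (simp add: sum_path_weight_Suc future_mean_step[symmetric] del: prod.lessThan_Suc)
qed

text \<open>Given the history \<open>h\<close>, averaging over the next letter costs a factor
  \<open>exp (l\<^sup>2 * (v k)\<^sup>2 / 8)\<close> by Hoeffding's lemma. The factor does not
  depend on \<open>h\<close>, so it leaves the sum and the factors accumulate over
  \<open>k\<close>.\<close>

lemma mgf_future_mean:
  fixes p :: "nat \<Rightarrow> 'a::finite list \<Rightarrow> 'a pmf"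
  assumes osc: "\<And>k h a b. k < N \<Longrightarrow> h \<in> words k \<Longrightarrow>
      \<bar>future_mean (N - Suc k) p f (h @ [a]) - future_mean (N - Suc k) p f (h @ [b])\<bar> \<le> v k"
    and "l > 0" "k \<le> N"
  shows "(\<Sum>x\<in>words k. path_weight k p x * exp (l * future_mean (N - k) p f x))
    \<le> exp (l * future_mean N p f [] + l\<^sup>2 / 8 * (\<Sum>j<k. (v j)\<^sup>2))"
  using \<open>k \<le> N\<close>
proof (induction k)
  case 0
  then show ?case by (simp add: words_def)
next
  case (Suc k)
  let ?G = "\<lambda>k. future_mean (N - k) p f"
  have "(\<Sum>x\<in>words (Suc k). path_weight (Suc k) p x * exp (l * ?G (Suc k) x))
      = (\<Sum>h\<in>words k. path_weight k p h * (\<Sum>a\<in>UNIV. pmf (p k h) a * exp (l * ?G (Suc k) (h @ [a]))))"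
    by (rule sum_path_weight_Suc)
  also have "\<dots> \<le> (\<Sum>h\<in>words k. path_weight k p h * exp (l * ?G k h + l\<^sup>2 * (v k)\<^sup>2 / 8))"
  proof (intro sum_mono mult_left_mono path_weight_nonneg)
    fix h :: "'a list" assume h: "h \<in> words k"
    show "(\<Sum>a\<in>UNIV. pmf (p k h) a * exp (l * ?G (Suc k) (h @ [a])))
        \<le> exp (l * ?G k h + l\<^sup>2 * (v k)\<^sup>2 / 8)"
      unfolding future_mean_step[OF Suc_le_lessD[OF Suc.prems] h]
      by (rule pmf_Hoeffdings_lemma) (use osc Suc.prems h \<open>l > 0\<close> in auto)
  qed
  also have "\<dots> = (\<Sum>h\<in>words k. path_weight k p h * exp (l * ?G k h)) * exp (l\<^sup>2 * (v k)\<^sup>2 / 8)"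
    by (simp add: exp_add sum_distrib_right mult.assoc)
  also have "\<dots> \<le> exp (l * future_mean N p f [] + l\<^sup>2 / 8 * (\<Sum>j<k. (v j)\<^sup>2)) * exp (l\<^sup>2 * (v k)\<^sup>2 / 8)"
    using Suc by (intro mult_right_mono) auto
  finally show ?case
    by (simp add: exp_add[symmetric] algebra_simps add_divide_distrib del: prod.lessThan_Suc)
qed

text \<open>Downward induction from \<open>k = N\<close>. The words stay general because the
  induction hypothesis is used twice: with \<open>w\<close> extended by a letter, and with the whole
  history in the role of \<open>z\<close> and an empty \<open>w\<close>.\<close>

lemma future_mean_oscillation:
  fixes p :: "nat \<Rightarrow> 'a::finite list \<Rightarrow> 'a pmf" and H :: "nat \<Rightarrow> nat \<Rightarrow> real"
  assumes lip: "\<And>z x x' w. length z + length w + 1 = N \<Longrightarrow>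
      \<bar>f (z @ [x] @ w) - f (z @ [x'] @ w)\<bar> \<le> c (length z)"
    and tv: "\<And>z x x' w j. length z + length w + 1 = j \<Longrightarrow> j < N \<Longrightarrow>
      tv_dist (p j (z @ [x] @ w)) (p j (z @ [x'] @ w)) \<le> H (length z) j"
    and v: "\<And>i. i < N \<Longrightarrow> v i = c i + (\<Sum>j\<in>{Suc i..<N}. H i j * v j)"
    and len: "length z + length w + 1 = k" and "k \<le> N"
  shows "\<bar>future_mean (N - k) p f (z @ [x] @ w) - future_mean (N - k) p f (z @ [x'] @ w)\<bar>
    \<le> c (length z) + (\<Sum>j\<in>{k..<N}. H (length z) j * v j)"
  using \<open>k \<le> N\<close> len
proof (induction k arbitrary: z x x' w rule: inc_induct)
  case base
  then show ?case using lip by simp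
next
  case (step k)
  let ?G = "\<lambda>k. future_mean (N - k) p f"
  let ?h = "z @ [x] @ w" and ?h' = "z @ [x'] @ w" and ?i = "length z"
  let ?\<mu> = "p k ?h" and ?\<nu> = "p k ?h'"
  have words: "?h \<in> words k" "?h' \<in> words k"
    using step.prems by (auto simp: words_def)
  define S where "S = c ?i + (\<Sum>j\<in>{Suc k..<N}. H ?i j * v j)"
  have past: "\<bar>?G (Suc k) (?h @ [a]) - ?G (Suc k) (?h' @ [a])\<bar> \<le> S" for a
    using step.IH[of z "w @ [a]" x x'] step.prems by (simp add: S_def)
  \<comment> \<open>Here the changed coordinate is the last one, with index \<open>k\<close>, so the
    bound from the induction hypothesis is the right-hand side of the recursion for
    \<open>v k\<close>.\<close>
  have osc: "\<bar>?G (Suc k) (?h' @ [a]) - ?G (Suc k) (?h' @ [b])\<bar> \<le> v k" for a b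
  proof -
    have "length ?h' = k"
      using words by (simp add: words_def)
    then show ?thesis
      using step.IH[of ?h' "[]" a b] v[OF \<open>k < N\<close>] by simp
  qed
  \<comment> \<open>The sign allows \<open>tv_dist\<close> to be replaced by its upper bound
    \<open>H\<close> in the product with \<open>v k\<close>.\<close>
  have "v k \<ge> 0"
    using osc[of undefined undefined] by simp
  \<comment> \<open>First the argument changes under the fixed law \<open>?\<mu>\<close>, then the
    law changes for the fixed argument \<open>?h'\<close>.\<close>
  have "?G k ?h - ?G k ?h' =
      (\<Sum>a\<in>UNIV. pmf ?\<mu> a * (?G (Suc k) (?h @ [a]) - ?G (Suc k) (?h' @ [a])))
    + (\<Sum>a\<in>UNIV. (pmf ?\<mu> a - pmf ?\<nu> a) * ?G (Suc k) (?h' @ [a]))"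
    unfolding future_mean_step[OF \<open>k < N\<close> words(1)] future_mean_step[OF \<open>k < N\<close> words(2)]
    by (simp add: sum.distrib[symmetric] sum_subtractf[symmetric] algebra_simps)
  also have "\<bar>\<dots>\<bar> \<le> S + tv_dist ?\<mu> ?\<nu> * v k"
  proof (intro order.trans[OF abs_triangle_ineq] add_mono)
    have "\<bar>\<Sum>a\<in>UNIV. pmf ?\<mu> a * (?G (Suc k) (?h @ [a]) - ?G (Suc k) (?h' @ [a]))\<bar>
        \<le> (\<Sum>a\<in>UNIV. \<bar>pmf ?\<mu> a * (?G (Suc k) (?h @ [a]) - ?G (Suc k) (?h' @ [a]))\<bar>)"
      by (rule sum_abs)
    also have "\<dots> \<le> (\<Sum>a\<in>UNIV. pmf ?\<mu> a * S)"
      unfolding abs_mult abs_of_nonneg[OF pmf_nonneg] by (intro sum_mono mult_left_mono past) auto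
    also have "\<dots> = S"
      by (simp add: sum_distrib_right[symmetric] sum_pmf_eq_1)
    finally show "\<bar>\<Sum>a\<in>UNIV. pmf ?\<mu> a * (?G (Suc k) (?h @ [a]) - ?G (Suc k) (?h' @ [a]))\<bar> \<le> S" .
    show "\<bar>\<Sum>a\<in>UNIV. (pmf ?\<mu> a - pmf ?\<nu> a) * ?G (Suc k) (?h' @ [a])\<bar> \<le> tv_dist ?\<mu> ?\<nu> * v k"
      by (rule sum_pmf_diff_le_tv_dist) (rule osc)
  qed
  also have "\<dots> \<le> S + H ?i k * v k"
    using tv[OF step.prems \<open>k < N\<close>] \<open>v k \<ge> 0\<close> by (intro add_left_mono mult_right_mono) auto
  also have "\<dots> = c ?i + (\<Sum>j\<in>{k..<N}. H ?i j * v j)"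
    using \<open>k < N\<close> by (simp add: S_def sum.atLeast_Suc_lessThan)
  finally show ?case .
qed

section \<open>The one-sided Chernoff bound\<close>

lemma path_measure_upper_tail:
  fixes p :: "nat \<Rightarrow> 'a::finite list \<Rightarrow> 'a pmf"
  assumes osc: "\<And>k h a b. k < N \<Longrightarrow> h \<in> words k \<Longrightarrow>
      \<bar>future_mean (N - Suc k) p f (h @ [a]) - future_mean (N - Suc k) p f (h @ [b])\<bar> \<le> v k"
    and s: "s = (\<Sum>k<N. (v k)\<^sup>2)" "s > 0" and "t > 0"
  shows "measure (path_measure N p) {x \<in> words N. f x - (\<integral>y. f y \<partial>path_measure N p) \<ge> t}
    \<le> exp (- (2 * t\<^sup>2 / s))"
proof -
  define E where "E = (\<integral>y. f y \<partial>path_measure N p)"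
  \<comment> \<open>This value minimises the exponent
    \<open>l\<^sup>2 / 8 * s - l * t\<close>.\<close>
  define l where "l = 4 * t / s"
  have "l > 0"
    using s \<open>t > 0\<close> by (simp add: l_def)
  have E: "E = future_mean N p f []"
    using expectation_future_mean[of N N p f] by (simp add: E_def integral_path_measure)
  let ?A = "{x \<in> words N. f x - E \<ge> t}"
  have "measure (path_measure N p) ?A = (\<Sum>x\<in>?A. path_weight N p x * 1)"
    by (simp add: measure_path_measure)
  \<comment> \<open>Markov's inequality: the exponent is nonnegative on \<open>?A\<close>.\<close>
  also have "\<dots> \<le> (\<Sum>x\<in>?A. path_weight N p x * exp (l * (f x - E - t)))"
    using \<open>l > 0\<close> by (intro sum_mono mult_left_mono path_weight_nonneg) auto
  also have "\<dots> \<le> (\<Sum>x\<in>words N. path_weight N p x * exp (l * (f x - E - t)))"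
    by (intro sum_mono2) (auto simp: finite_words path_weight_nonneg)
  also have "\<dots> = (\<Sum>x\<in>words N. path_weight N p x * exp (l * f x)) * exp (- l * (E + t))"
    unfolding sum_distrib_right
    by (intro sum.cong refl) (simp add: mult.assoc exp_add[symmetric] right_diff_distrib distrib_left)
  also have "\<dots> \<le> exp (l * E + l\<^sup>2 / 8 * s) * exp (- l * (E + t))"
    using mgf_future_mean[where k = N, OF osc \<open>l > 0\<close>] by (intro mult_right_mono) (simp_all add: E s)
  also have "\<dots> = exp (l\<^sup>2 / 8 * s - l * t)"
    by (simp add: exp_add[symmetric] algebra_simps)
  also have "l\<^sup>2 / 8 * s - l * t = - (2 * t\<^sup>2 / s)"
    using \<open>s > 0\<close> by (simp add: l_def field_simps power2_eq_square)
  finally show ?thesis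
    by (simp add: E_def)
qed

section \<open>The matrix \<open>H\<close> and the equation for \<open>v\<close>\<close>

lemma tv_dist_le_interdependence_mat:
  fixes p :: "nat \<Rightarrow> 'a::finite list \<Rightarrow> 'a pmf"
  assumes len: "length z + length w + 1 = j" and "j < N"
  shows "tv_dist (p j (z @ [x] @ w)) (p j (z @ [x'] @ w)) \<le> interdependence_mat N p $$ (length z, j)"
proof -
  let ?i = "length z"
  let ?T = "{tv_dist (p j (z @ [x] @ w)) (p j (z @ [x'] @ w)) | z x x' w.
      z \<in> words ?i \<and> w \<in> words (j - ?i - 1)}"
  \<comment> \<open>As an image of a finite product \<open>?T\<close> is finite, so
    \<open>Max\<close> bounds its elements.\<close>
  have "?T = (\<lambda>(z, x, x', w). tv_dist (p j (z @ [x] @ w)) (p j (z @ [x'] @ w))) `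
      (words ?i \<times> UNIV \<times> UNIV \<times> words (j - ?i - 1))"
    by (force simp: image_iff)
  then have "finite ?T"
    by (simp add: finite_words)
  moreover have "z \<in> words ?i" "w \<in> words (j - ?i - 1)"
    using len by (auto simp: words_def)
  ultimately have "tv_dist (p j (z @ [x] @ w)) (p j (z @ [x'] @ w)) \<le> Max ?T"
    by (intro Max_ge) blast+
  then show ?thesis
    using assms by (simp add: interdependence_mat_def)
qed

text \<open>This is row \<open>i\<close> of \<open>(I - H) v = c\<close>; strict upper triangularity
  cuts the sum to \<open>j > i\<close>.\<close>

lemma resolvent_mat_fixpoint:
  fixes p :: "nat \<Rightarrow> 'a::finite list \<Rightarrow> 'a pmf"
  assumes c: "c \<in> carrier_vec N" and "i < N"
  defines "v \<equiv> resolvent_mat N p *\<^sub>v c"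
  shows "v $ i = c $ i + (\<Sum>j\<in>{Suc i..<N}. interdependence_mat N p $$ (i, j) * v $ j)"
proof -
  let ?H = "interdependence_mat N p"
  note R = resolvent_mat_inverse[where N = N and p = p]
  have H: "?H \<in> carrier_mat N N"
    by (simp add: interdependence_mat_def)
  have v: "v \<in> carrier_vec N"
    using R(1) c by (simp add: v_def)
  have "c = (1\<^sub>m N - ?H) *\<^sub>v v"
    unfolding v_def using R(1,2) H c
    by (subst assoc_mult_mat_vec[symmetric, where n\<^sub>1 = N and n\<^sub>2 = N and n\<^sub>3 = N]) auto
  also have "\<dots> = v - ?H *\<^sub>v v"
    using H v by (simp add: minus_mult_distrib_mat_vec[where nr = N and nc = N])
  finally have "c $ i = v $ i - (?H *\<^sub>v v) $ i"
    using H v \<open>i < N\<close> by simp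
  also have "(?H *\<^sub>v v) $ i = (\<Sum>j\<in>{0..<N}. ?H $$ (i, j) * v $ j)"
    using H v \<open>i < N\<close> by (simp add: scalar_prod_def)
  also have "\<dots> = (\<Sum>j\<in>{Suc i..<N}. ?H $$ (i, j) * v $ j)"
    using \<open>i < N\<close> by (intro sum.mono_neutral_right) (auto simp: interdependence_mat_def)
  finally show ?thesis by simp
qed

section \<open>The two-sided bound and its degenerate cases\<close>

theorem theorem3p1:
  fixes N :: nat
    and p :: "nat \<Rightarrow> 'a::finite list \<Rightarrow> 'a pmf"
    and f :: "'a list \<Rightarrow> real"
    and c :: "real Matrix.vec"
    and t :: real
  assumes "N \<ge> 1"
    and "c \<in> carrier_vec N"
    and "\<And>x y. x \<in> words N \<Longrightarrow> y \<in> words N \<Longrightarrow>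
           \<bar>f x - f y\<bar> \<le> (\<Sum>j<N. c $ j * of_bool (x ! j \<noteq> y ! j))"
    and "t > 0"
  shows "measure (path_measure N p)
           {x \<in> space (path_measure N p). \<bar>f x - (\<integral>y. f y \<partial>path_measure N p)\<bar> \<ge> t}
         \<le> (let s = (\<Sum>k<N. ((resolvent_mat N p *\<^sub>v c) $ k)\<^sup>2)
             in if s = 0 then 0 else 2 * exp (- (2 * t\<^sup>2 / s)))"
proof -
  define v where "v = (\<lambda>k. (resolvent_mat N p *\<^sub>v c) $ k)"
  define s where "s = (\<Sum>k<N. (v k)\<^sup>2)"
  have "s \<ge> 0"
    by (simp add: s_def sum_nonneg)
  let ?M = "path_measure N p"
  interpret prob_space ?M by (rule prob_space_path_measure)
  define E where "E = (\<integral>y. f y \<partial>?M)"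
  have space: "space ?M = words N"
    by (simp add: path_measure_def space_point_measure)
  have sets: "A \<in> sets ?M" if "A \<subseteq> words N" for A
    using that by (simp add: path_measure_def sets_point_measure)
  \<comment> \<open>For constant \<open>f\<close> the deviation set is empty since
    \<open>t > 0\<close>, and both branches of the bound are nonnegative. This settles the
    one-letter alphabet and the case \<open>s = 0\<close>.\<close>
  have const: ?thesis if eq: "\<And>x y. x \<in> words N \<Longrightarrow> y \<in> words N \<Longrightarrow> f x = f y"
  proof -
    have "E = f x" if "x \<in> words N" for x
    proof -
      have "E = (\<Sum>y\<in>words N. path_weight N p y * f x)"
        unfolding E_def integral_path_measure using that by (intro sum.cong refl) (metis eq)
      then show ?thesis
        by (simp add: sum_distrib_right[symmetric] sum_path_weights)
    qed
    then have empty: "{x \<in> space ?M. \<bar>f x - E\<bar> \<ge> t} = {}"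
      using \<open>t > 0\<close> by (auto simp: space)
    show ?thesis
      unfolding E_def[symmetric] empty by (simp add: Let_def)
  qed
  show ?thesis
  \<comment> \<open>Over one letter the Lipschitz condition does not determine the sign of
    \<open>c\<close>; two distinct letters force \<open>c \<ge> 0\<close>.\<close>
  proof (cases "\<exists>a b :: 'a. a \<noteq> b")
    case False
    then have "x = y" for x y :: 'a by blast
    then have "x = y" if "x \<in> words N" "y \<in> words N" for x y :: "'a list"
      using that by (auto simp: words_def intro: nth_equalityI)
    then show ?thesis by (intro const) metis
  next
    case True
    then obtain a b :: 'a where ab: "a \<noteq> b" by blast
    have single: "\<bar>f (z @ [x] @ w) - f (z @ [x'] @ w)\<bar> \<le> c $ length z * of_bool (x \<noteq> x')"
      if len: "length z + length w + 1 = N" for z x x' w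
    proof -
      have "\<bar>f (z @ [x] @ w) - f (z @ [x'] @ w)\<bar>
          \<le> (\<Sum>j<N. c $ j * of_bool ((z @ [x] @ w) ! j \<noteq> (z @ [x'] @ w) ! j))"
        using len by (intro assms(3)) (auto simp: words_def)
      also have "\<dots> = (\<Sum>j<N. if j = length z then c $ j * of_bool (x \<noteq> x') else 0)"
        by (intro sum.cong refl) (auto simp: nth_append nth_Cons split: nat.split)
      finally show ?thesis using len by simp
    qed
    \<comment> \<open>Two words that differ exactly at \<open>i\<close> bound an absolute value by
      \<open>c $ i\<close>.\<close>
    have c_nonneg: "c $ i \<ge> 0" if "i < N" for i
      using single[of "replicate i a" "replicate (N - i - 1) a" a b] that ab by simp
    have lip: "\<bar>f (z @ [x] @ w) - f (z @ [x'] @ w)\<bar> \<le> c $ length z"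
      if "length z + length w + 1 = N" for z x x' w
      using single[OF that, of x x'] c_nonneg[of "length z"] that by (cases "x = x'") auto
    have v: "v i = c $ i + (\<Sum>j\<in>{Suc i..<N}. interdependence_mat N p $$ (i, j) * v j)" if "i < N" for i
      unfolding v_def by (rule resolvent_mat_fixpoint) (use assms that in auto)
    \<comment> \<open>The function \<open>g\<close> is kept general so that both \<open>f\<close>
      and its negative qualify.\<close>
    have osc: "\<bar>future_mean (N - Suc k) p g (h @ [x]) - future_mean (N - Suc k) p g (h @ [x'])\<bar> \<le> v k"
      if "k < N" "h \<in> words k"
        and "\<And>z x x' w. length z + length w + 1 = N \<Longrightarrow>
          \<bar>g (z @ [x] @ w) - g (z @ [x'] @ w)\<bar> \<le> c $ length z" for g k h x x'
    proof -
      have "\<bar>future_mean (N - Suc k) p g (h @ [x] @ []) - future_mean (N - Suc k) p g (h @ [x'] @ [])\<bar>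
        \<le> c $ length h + (\<Sum>j\<in>{Suc k..<N}. interdependence_mat N p $$ (length h, j) * v j)"
        using that
        by (intro future_mean_oscillation[OF _ tv_dist_le_interdependence_mat v])
           (auto simp: words_def)
      then show ?thesis
        using v that by (simp add: words_def)
    qed
    show ?thesis
    proof (cases "s = 0")
      case True
      then have v0: "v k = 0" if "k < N" for k
        using that by (simp add: s_def sum_nonneg_eq_0_iff)
      \<comment> \<open>From \<open>v = 0\<close> and \<open>c = v - H v\<close>.\<close>
      have "c $ k = 0" if "k < N" for k
        using v[OF that] that by (simp add: v0)
      then have "f x = f y" if "x \<in> words N" "y \<in> words N" for x y
        using assms(3)[OF that] by simp
      then show ?thesis by (rule const)
    next
      case False
      then have "s > 0" using \<open>s \<ge> 0\<close> by simp
      have up: "measure ?M {x \<in> words N. f x - E \<ge> t} \<le> exp (- (2 * t\<^sup>2 / s))"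
        unfolding E_def using \<open>s > 0\<close> \<open>t > 0\<close>
        by (intro path_measure_upper_tail[where v = v] osc lip) (auto simp: s_def)
      \<comment> \<open>The lower tail is the upper tail of \<open>- f\<close>, which has the same
        Lipschitz constants.\<close>
      have lip': "\<bar>- f (z @ [x] @ w) - - f (z @ [x'] @ w)\<bar> \<le> c $ length z"
        if "length z + length w + 1 = N" for z x x' w
        using lip[OF that, of x x'] by simp
      have "measure ?M {x \<in> words N. - f x - (\<integral>y. - f y \<partial>?M) \<ge> t} \<le> exp (- (2 * t\<^sup>2 / s))"
        using \<open>s > 0\<close> \<open>t > 0\<close>
        by (intro path_measure_upper_tail[where v = v] osc lip') (auto simp: s_def)
      then have low: "measure ?M {x \<in> words N. E - f x \<ge> t} \<le> exp (- (2 * t\<^sup>2 / s))"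
        by (simp add: E_def)
      have "{x \<in> words N. \<bar>f x - E\<bar> \<ge> t} =
          {x \<in> words N. f x - E \<ge> t} \<union> {x \<in> words N. E - f x \<ge> t}"
        by auto
      then have "measure ?M {x \<in> words N. \<bar>f x - E\<bar> \<ge> t}
          \<le> measure ?M {x \<in> words N. f x - E \<ge> t} + measure ?M {x \<in> words N. E - f x \<ge> t}"
        by (simp add: measure_Un_le sets)
      also have "\<dots> \<le> 2 * exp (- (2 * t\<^sup>2 / s))"
        using up low by simp
      finally show ?thesis
        using \<open>s > 0\<close> unfolding s_def v_def E_def space Let_def by simp
    qed
  qed
qed

end
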